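(* Let $F$ be a Generalized Flowerbed of size $n$, and let $F_t$ be its trimmed form, a Generalized Flowerbed of size $n_t$. Then $o^+(F)=o^-(F^* )=o^+(F_t)=o^-((F_t)^* )$.
   Context: Hackenbush: finite graph with blue, red or green edges and ground vertices; Left cuts blue or green edges, Right cuts red or green; components disconnected from the ground are discarded. Normal play: last mover wins; misère play: last mover loses; $o^+$, $o^-$ are outcome classes. A Stalk of height $h$ is a path of $h$ green edges on the ground; $*$ is a Stalk of height 1. A Generalized Flower $*_h:(x)$ is a green path of $h\ge1$ edges (stem) whose bottom vertex is the only ground vertex, with a red–blue Hackenbush position (Blossom) of normal-play value $x$ attached at the top vertex; blue if $x>0$, red if $x<0$. A Generalized Flowerbed of size $n$ is a disjunctive sum of $n$ blue Generalized Flowers, $n$ red Generalized Flowers and a (possibly empty) sum of Stalks. A blue and a red Generalized Flower cancel if they have the same height and blossom values $x$ and $-x$. The trimmed form $F_t$ is the minimal Generalized Flowerbed obtained from $F$ by removing pairs of canceling Generalized Flowers. For a disjunctive sum $G$ of Generalized Flowers and Stalks, the evil twin is $G^*=G$ if some summand has height at least $2$, and $G^*=G+*$ if every summand has height $1$. *)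

theory Defs
  imports "HOL-Library.Multiset" "HOL-Library.FSet"
begin

section \<open>Short games, disjunctive sums and outcomes\<close>

datatype game = Game (left_opts: "game fset") (right_opts: "game fset")

datatype player = Left | Right

fun opponent :: "player \<Rightarrow> player" where
  "opponent Left = Right"
| "opponent Right = Left"

fun options :: "player \<Rightarrow> game \<Rightarrow> game fset" where
  "options Left G = left_opts G"
| "options Right G = right_opts G"

lemma size_option: "G' |\<in>| options p G \<Longrightarrow> size G' < size G"
proof -
  have *: "x |\<in>| A \<Longrightarrow> size x \<le> (\<Sum>x\<in>fset A. Suc (size x))" for x :: game and A
    using member_le_sum[of x "fset A" "\<lambda>x. Suc (size x)"] by simp
  show "G' |\<in>| options p G \<Longrightarrow> size G' < size G"
    by (cases G; cases p) (auto dest!: *)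
qed

lemma size_left_option: "G' |\<in>| left_opts G \<Longrightarrow> size G' < size G"
  using size_option[of G' Left G] by simp

lemma size_right_option: "G' |\<in>| right_opts G \<Longrightarrow> size G' < size G"
  using size_option[of G' Right G] by simp

lemma game_option_induct [case_names options]:
  assumes "\<And>G. (\<And>G'. G' |\<in>| left_opts G \<Longrightarrow> P G') \<Longrightarrow>
                (\<And>G'. G' |\<in>| right_opts G \<Longrightarrow> P G') \<Longrightarrow> P G"
  shows "P G"
  by (induction G rule: measure_induct_rule[of size])
     (auto intro: assms size_left_option size_right_option)

instantiation game :: "{zero, plus, uminus}"
begin

definition zero_game :: game where
  "0 = Game {||} {||}"

function plus_game :: "game \<Rightarrow> game \<Rightarrow> game" where
  "plus_game G H = Game
     ((\<lambda>G'. plus_game G' H) |`| left_opts G |\<union>| (\<lambda>H'. plus_game G H') |`| left_opts H)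
     ((\<lambda>G'. plus_game G' H) |`| right_opts G |\<union>| (\<lambda>H'. plus_game G H') |`| right_opts H)"
  by auto
termination
  by (relation "measure (\<lambda>(G, H). size G + size H)")
     (auto simp: size_left_option size_right_option)

function uminus_game :: "game \<Rightarrow> game" where
  "uminus_game G = Game (uminus_game |`| right_opts G) (uminus_game |`| left_opts G)"
  by auto
termination
  by (relation "measure size") (auto simp: size_left_option size_right_option)

instance ..

end

declare plus_game.simps [simp del] uminus_game.simps [simp del]

lemma left_opts_plus [simp]:
  "left_opts (G + H) = (\<lambda>G'. G' + H) |`| left_opts G |\<union>| (\<lambda>H'. G + H') |`| left_opts H"
  by (subst plus_game.simps) simp

lemma right_opts_plus [simp]:
  "right_opts (G + H) = (\<lambda>G'. G' + H) |`| right_opts G |\<union>| (\<lambda>H'. G + H') |`| right_opts H"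
  by (subst plus_game.simps) simp

lemma left_opts_uminus [simp]: "left_opts (- G) = uminus |`| right_opts (G :: game)"
  by (subst uminus_game.simps) simp

lemma right_opts_uminus [simp]: "right_opts (- G) = uminus |`| left_opts (G :: game)"
  by (subst uminus_game.simps) simp

lemma game_plus_commute: "G + H = H + (G :: game)"
proof (induction "size G + size H" arbitrary: G H rule: less_induct)
  case less
  have IH: "G' + H' = H' + G'" if "size G' + size H' < size G + size H" for G' H' :: game
    using less that by blast
  have "(\<lambda>G'. G' + H) |`| left_opts G = (\<lambda>G'. H + G') |`| left_opts G"
    "(\<lambda>H'. G + H') |`| left_opts H = (\<lambda>H'. H' + G) |`| left_opts H"
    "(\<lambda>G'. G' + H) |`| right_opts G = (\<lambda>G'. H + G') |`| right_opts G"
    "(\<lambda>H'. G + H') |`| right_opts H = (\<lambda>H'. H' + G) |`| right_opts H"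
    by (intro fset.map_cong refl IH; simp add: size_left_option size_right_option)+
  then show ?case
    by (intro game.expand) (simp add: sup_commute)
qed

lemma game_plus_assoc: "(G + H) + K = G + (H + (K :: game))"
proof (induction "size G + size H + size K" arbitrary: G H K rule: less_induct)
  case less
  have IH: "(G' + H') + K' = G' + (H' + K')"
    if "size G' + size H' + size K' < size G + size H + size K" for G' H' K' :: game
    using less that by blast
  have
    "(\<lambda>x. (x + H) + K) |`| left_opts G = (\<lambda>x. x + (H + K)) |`| left_opts G"
    "(\<lambda>x. (G + x) + K) |`| left_opts H = (\<lambda>x. G + (x + K)) |`| left_opts H"
    "(\<lambda>x. (G + H) + x) |`| left_opts K = (\<lambda>x. G + (H + x)) |`| left_opts K"
    "(\<lambda>x. (x + H) + K) |`| right_opts G = (\<lambda>x. x + (H + K)) |`| right_opts G"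
    "(\<lambda>x. (G + x) + K) |`| right_opts H = (\<lambda>x. G + (x + K)) |`| right_opts H"
    "(\<lambda>x. (G + H) + x) |`| right_opts K = (\<lambda>x. G + (H + x)) |`| right_opts K"
    by (intro fset.map_cong refl IH; simp add: size_left_option size_right_option)+
  then show ?case
    by (intro game.expand) (simp add: fimage_funion fset.map_comp comp_def sup_assoc)
qed

lemma game_zero_plus: "0 + G = (G :: game)"
proof (induction G rule: game_option_induct)
  case (options G)
  have "(\<lambda>x. 0 + x) |`| left_opts G = (\<lambda>x. x) |`| left_opts G"
    "(\<lambda>x. 0 + x) |`| right_opts G = (\<lambda>x. x) |`| right_opts G"
    by (intro fset.map_cong refl options; simp)+
  then show ?case
    by (intro game.expand) (simp add: zero_game_def)
qed

instance game :: comm_monoid_add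
  by standard (fact game_plus_assoc game_plus_commute game_zero_plus)+

lemma game_uminus_uminus [simp]: "- (- G) = (G :: game)"
proof (induction G rule: game_option_induct)
  case (options G)
  have "(\<lambda>x. - (- x)) |`| left_opts G = (\<lambda>x. x) |`| left_opts G"
    "(\<lambda>x. - (- x)) |`| right_opts G = (\<lambda>x. x) |`| right_opts G"
    by (intro fset.map_cong refl options; simp)+
  then show ?case
    by (intro game.expand) (simp add: fset.map_comp comp_def)
qed

lemma game_uminus_plus: "- (G + H) = - G + - (H :: game)"
proof (induction "size G + size H" arbitrary: G H rule: less_induct)
  case less
  have IH: "- (G' + H') = - G' + - H'" if "size G' + size H' < size G + size H" for G' H' :: game
    using less that by blast
  have "(\<lambda>x. - (x + H)) |`| left_opts G = (\<lambda>x. - x + - H) |`| left_opts G"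
    "(\<lambda>x. - (G + x)) |`| left_opts H = (\<lambda>x. - G + - x) |`| left_opts H"
    "(\<lambda>x. - (x + H)) |`| right_opts G = (\<lambda>x. - x + - H) |`| right_opts G"
    "(\<lambda>x. - (G + x)) |`| right_opts H = (\<lambda>x. - G + - x) |`| right_opts H"
    by (intro fset.map_cong refl IH; simp add: size_left_option size_right_option)+
  then show ?case
    by (intro game.expand) (simp add: fimage_funion fset.map_comp comp_def)
qed

datatype play = Normal | Misere

text \<open>\<open>wins_first c p G\<close>: player \<open>p\<close> wins \<open>G\<close> moving first under play convention \<open>c\<close>.\<close>

function wins_first :: "play \<Rightarrow> player \<Rightarrow> game \<Rightarrow> bool" where
  "wins_first c p G \<longleftrightarrow>
     (c = Misere \<and> options p G = {||}) \<or>
     (\<exists>G' \<in> fset (options p G). \<not> wins_first c (opponent p) G')"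
  by auto
termination
  by (relation "measure (\<lambda>(c, p, G). size G)") (auto simp: size_option)

declare wins_first.simps [simp del]

datatype outcome = outL | outN | outP | outR

definition outcome :: "play \<Rightarrow> game \<Rightarrow> outcome" where
  "outcome c G =
     (if wins_first c Left G
      then (if wins_first c Right G then outN else outL)
      else (if wins_first c Right G then outR else outP))"

abbreviation outcome_normal :: "game \<Rightarrow> outcome" (\<open>o\<^sup>+\<close>) where
  "o\<^sup>+ \<equiv> outcome Normal"

abbreviation outcome_misere :: "game \<Rightarrow> outcome" (\<open>o\<^sup>-\<close>) where
  "o\<^sup>- \<equiv> outcome Misere"

text \<open>The order by favourability to Left: \<open>outR < outN, outP < outL\<close>,
  with \<open>outN\<close> and \<open>outP\<close> incomparable.\<close>

instantiation outcome :: order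
begin

definition less_eq_outcome :: "outcome \<Rightarrow> outcome \<Rightarrow> bool" where
  "a \<le> b \<longleftrightarrow> a = b \<or> a = outR \<or> b = outL"

definition less_outcome :: "outcome \<Rightarrow> outcome \<Rightarrow> bool" where
  "a < b \<longleftrightarrow> a \<le> b \<and> \<not> b \<le> (a :: outcome)"

instance
  by standard (auto simp: less_eq_outcome_def less_outcome_def)

end

fun outcome_conj :: "outcome \<Rightarrow> outcome" where
  "outcome_conj outL = outR"
| "outcome_conj outR = outL"
| "outcome_conj outN = outN"
| "outcome_conj outP = outP"

lemma outcome_conj_inject [simp]: "outcome_conj a = outcome_conj b \<longleftrightarrow> a = b"
  by (cases a; cases b) auto

lemma wins_first_uminus: "wins_first c p (- G) \<longleftrightarrow> wins_first c (opponent p) G"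
proof (induction G arbitrary: p rule: game_option_induct)
  case (options G)
  show ?case
    by (cases p; subst (1 2) wins_first.simps) (auto simp: options)
qed

lemma outcome_uminus: "outcome c (- G) = outcome_conj (outcome c G)"
  by (simp add: outcome_def wins_first_uminus)

section \<open>Normal-play values\<close>

quotient_type nvalue = game / "\<lambda>G H. \<forall>X. o\<^sup>+ (G + X) = o\<^sup>+ (H + X)"
  by (intro equivpI reflpI sympI transpI) auto

instantiation nvalue :: "{zero, uminus, order}"
begin

lift_definition zero_nvalue :: nvalue is "0 :: game" .

lift_definition uminus_nvalue :: "nvalue \<Rightarrow> nvalue" is "uminus :: game \<Rightarrow> game"
  by (metis outcome_conj_inject outcome_uminus game_uminus_plus game_uminus_uminus)

lift_definition less_eq_nvalue :: "nvalue \<Rightarrow> nvalue \<Rightarrow> bool" is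
  "\<lambda>G H. \<forall>X. o\<^sup>+ (G + X) \<le> o\<^sup>+ (H + X)"
  by simp

definition less_nvalue :: "nvalue \<Rightarrow> nvalue \<Rightarrow> bool" where
  "x < y \<longleftrightarrow> x \<le> y \<and> \<not> y \<le> (x :: nvalue)"

instance
proof
  fix x y z :: nvalue
  show "x < y \<longleftrightarrow> x \<le> y \<and> \<not> y \<le> x"
    by (fact less_nvalue_def)
  show "x \<le> x"
    by transfer simp
  show "x \<le> y \<Longrightarrow> y \<le> z \<Longrightarrow> x \<le> z"
    by transfer (blast intro: order_trans)
  show "x \<le> y \<Longrightarrow> y \<le> x \<Longrightarrow> x = y"
    by transfer (blast intro: order_antisym)
qed

end

section \<open>Hackenbush\<close>

datatype color = Blue | Red | Green

text \<open>The order of the two endpoints of an edge is irrelevant. Edges form a multiset, so parallel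
  edges (and loops) are allowed; vertices other than ground vertices exist only as endpoints.\<close>

datatype edge = Edge (ecolor: color) (end1: nat) (end2: nat)

datatype hackenbush = Hackenbush (ground: "nat set") (edges: "edge multiset")

definition adjacency :: "hackenbush \<Rightarrow> (nat \<times> nat) set" where
  "adjacency G = {(u, v). \<exists>c. Edge c u v \<in># edges G \<or> Edge c v u \<in># edges G}"

definition grounded :: "hackenbush \<Rightarrow> nat set" where
  "grounded G = (adjacency G)\<^sup>* `` ground G"

definition discard_disconnected :: "hackenbush \<Rightarrow> hackenbush" where
  "discard_disconnected G =
     Hackenbush (ground G) {#e \<in># edges G. end1 e \<in> grounded G \<and> end2 e \<in> grounded G#}"

definition hackenbush_position :: "hackenbush \<Rightarrow> bool" where
  "hackenbush_position G \<longleftrightarrow> finite (ground G) \<and> discard_disconnected G = G"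

definition cut :: "edge \<Rightarrow> hackenbush \<Rightarrow> hackenbush" where
  "cut e G = discard_disconnected (Hackenbush (ground G) (edges G - {#e#}))"

fun may_cut :: "player \<Rightarrow> color set" where
  "may_cut Left = {Blue, Green}"
| "may_cut Right = {Red, Green}"

context
  includes fset.lifting
begin

lift_definition cuttable :: "player \<Rightarrow> hackenbush \<Rightarrow> edge fset" is
  "\<lambda>p G. {e. e \<in># edges G \<and> ecolor e \<in> may_cut p}"
  by simp

lemma cuttable_iff: "e |\<in>| cuttable p G \<longleftrightarrow> e \<in># edges G \<and> ecolor e \<in> may_cut p"
  by transfer simp

end

lemma size_cut:
  assumes "e |\<in>| cuttable p G"
  shows "size (edges (cut e G)) < size (edges G)"
proof -
  have e: "e \<in># edges G"
    using assms by (simp add: cuttable_iff)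
  have "size (edges (cut e G)) \<le> size (edges G - {#e#})"
    unfolding cut_def discard_disconnected_def hackenbush.sel by (rule size_filter_mset_lesseq)
  also have "\<dots> < size (edges G)"
    using e by (rule size_Diff1_less)
  finally show ?thesis .
qed

function hackenbush_game :: "hackenbush \<Rightarrow> game" where
  "hackenbush_game G = Game
     ((\<lambda>e. hackenbush_game (cut e G)) |`| cuttable Left G)
     ((\<lambda>e. hackenbush_game (cut e G)) |`| cuttable Right G)"
  by auto
termination
  by (relation "measure (\<lambda>G. size (edges G))") (auto simp: size_cut)

declare hackenbush_game.simps [simp del]

definition red_blue :: "hackenbush \<Rightarrow> bool" where
  "red_blue G \<longleftrightarrow> (\<forall>e \<in># edges G. ecolor e \<noteq> Green)"

definition hackenbush_value :: "hackenbush \<Rightarrow> nvalue" where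
  "hackenbush_value G = abs_nvalue (hackenbush_game G)"

section \<open>Stalks, Generalized Flowers and Generalized Flowerbeds\<close>

definition stem :: "nat \<Rightarrow> edge multiset" where
  "stem h = {#Edge Green i (Suc i). i \<in># mset_set {..<h}#}"

definition stalk_graph :: "nat \<Rightarrow> hackenbush" where
  "stalk_graph h = Hackenbush {0} (stem h)"

text \<open>The stem has vertices \<open>0, \<dots>, h\<close>. The blossom \<open>B\<close> is attached by identifying all its ground
  vertices with the top vertex \<open>h\<close>; its other vertices are shifted away from the stem.\<close>

definition attach_vertex :: "nat \<Rightarrow> hackenbush \<Rightarrow> nat \<Rightarrow> nat" where
  "attach_vertex h B v = (if v \<in> ground B then h else Suc h + v)"

definition attach_edge :: "nat \<Rightarrow> hackenbush \<Rightarrow> edge \<Rightarrow> edge" where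
  "attach_edge h B e =
     Edge (ecolor e) (attach_vertex h B (end1 e)) (attach_vertex h B (end2 e))"

definition flower_graph :: "nat \<Rightarrow> hackenbush \<Rightarrow> hackenbush" where
  "flower_graph h B = Hackenbush {0} (stem h + image_mset (attach_edge h B) (edges B))"

datatype plant = Stalk (height: nat) | Flower (height: nat) (blossom: hackenbush)

fun plant_game :: "plant \<Rightarrow> game" where
  "plant_game (Stalk h) = hackenbush_game (stalk_graph h)"
| "plant_game (Flower h B) = hackenbush_game (flower_graph h B)"

fun is_stalk :: "plant \<Rightarrow> bool" where
  "is_stalk (Stalk h) \<longleftrightarrow> h \<ge> 1"
| "is_stalk (Flower h B) \<longleftrightarrow> False"

fun generalized_flower :: "plant \<Rightarrow> bool" where
  "generalized_flower (Stalk h) \<longleftrightarrow> False"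
| "generalized_flower (Flower h B) \<longleftrightarrow> h \<ge> 1 \<and> hackenbush_position B \<and> red_blue B"

definition blue_flower :: "plant \<Rightarrow> bool" where
  "blue_flower f \<longleftrightarrow> generalized_flower f \<and> hackenbush_value (blossom f) > 0"

definition red_flower :: "plant \<Rightarrow> bool" where
  "red_flower f \<longleftrightarrow> generalized_flower f \<and> hackenbush_value (blossom f) < 0"

text \<open>A disjunctive sum of plants is given by the multiset of its summands.\<close>

definition sum_game :: "plant multiset \<Rightarrow> game" where
  "sum_game F = (\<Sum>f \<in># F. plant_game f)"

definition generalized_flowerbed :: "nat \<Rightarrow> plant multiset \<Rightarrow> bool" where
  "generalized_flowerbed n F \<longleftrightarrow> (\<exists>B R S. F = B + R + S \<and>
     size B = n \<and> (\<forall>f \<in># B. blue_flower f) \<and>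
     size R = n \<and> (\<forall>f \<in># R. red_flower f) \<and>
     (\<forall>f \<in># S. is_stalk f))"

definition cancel :: "plant \<Rightarrow> plant \<Rightarrow> bool" where
  "cancel b r \<longleftrightarrow> blue_flower b \<and> red_flower r \<and> height b = height r \<and>
     hackenbush_value (blossom r) = - hackenbush_value (blossom b)"

definition remove_pair :: "plant multiset \<Rightarrow> plant multiset \<Rightarrow> bool" where
  "remove_pair F F' \<longleftrightarrow> (\<exists>b r. cancel b r \<and> F = F' + {#b, r#})"

text \<open>Blossoms of equal value may be different graphs, so \<open>F\<close> determines its trimmed form only up to
  the choice of which of several flowers of equal height and value remain.\<close>

definition trimmed_form :: "plant multiset \<Rightarrow> plant multiset \<Rightarrow> bool" where
  "trimmed_form F F\<^sub>t \<longleftrightarrow> remove_pair\<^sup>*\<^sup>* F F\<^sub>t \<and>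
     (\<forall>F'. remove_pair\<^sup>*\<^sup>* F F' \<longrightarrow> \<not> F' \<subset># F\<^sub>t)"

definition evil_twin :: "plant multiset \<Rightarrow> plant multiset" where
  "evil_twin F = (if \<exists>f \<in># F. height f \<ge> 2 then F else F + {#Stalk 1#})"

lemma remove_pair_flowerbed:
  assumes "remove_pair F F'" "generalized_flowerbed n F"
  shows "\<exists>m. generalized_flowerbed m F'"
proof -
  obtain b r where c: "cancel b r" and F: "F = F' + {#b, r#}"
    using assms(1) by (auto simp: remove_pair_def)
  obtain B R S where *: "F = B + R + S" "size B = n" "size R = n"
    "\<forall>f\<in>#B. blue_flower f" "\<forall>f\<in>#R. red_flower f" "\<forall>f\<in>#S. is_stalk f"
    using assms(2) by (auto simp: generalized_flowerbed_def)
  have b: "blue_flower b" and r: "red_flower r"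
    using c by (auto simp: cancel_def)
  have excl: "\<not> (blue_flower f \<and> red_flower f)" "\<not> (blue_flower f \<and> is_stalk f)"
    "\<not> (red_flower f \<and> is_stalk f)" for f
    by (cases f; auto simp: blue_flower_def red_flower_def)+
  have "b \<in># F" "r \<in># F"
    using F by auto
  then have "b \<in># B" "r \<in># R"
    using * b r excl by auto
  then obtain B' R' where B': "B = add_mset b B'" and R': "R = add_mset r R'"
    by (meson mset_add)
  have "F' = B' + R' + S"
    using F *(1) B' R' by (simp add: ac_simps)
  moreover have "size B' = n - 1" "size R' = n - 1"
    using * B' R' by auto
  ultimately have "generalized_flowerbed (n - 1) F'"
    using * B' R' unfolding generalized_flowerbed_def by (metis insert_noteq_member union_iff add_mset_remove_trivial in_diffD)
  then show ?thesis ..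
qed

lemma trimmed_form_flowerbed:
  assumes "generalized_flowerbed n F" "trimmed_form F F\<^sub>t"
  shows "\<exists>m. generalized_flowerbed m F\<^sub>t"
proof -
  have "remove_pair\<^sup>*\<^sup>* F F\<^sub>t"
    using assms(2) by (simp add: trimmed_form_def)
  then show ?thesis
    by (induction rule: rtranclp_induct) (use assms(1) remove_pair_flowerbed in blast)+
qed

lemma trimmed_form_exists: "\<exists>F\<^sub>t. trimmed_form F F\<^sub>t"
proof -
  let ?P = "\<lambda>F'. remove_pair\<^sup>*\<^sup>* F F'"
  obtain M where "?P M" "\<And>F'. ?P F' \<Longrightarrow> size M \<le> size F'"
    using ex_has_least_nat[of ?P F size] by auto
  then show ?thesis
    unfolding trimmed_form_def by (meson mset_subset_size not_le)
qed

end

theory Submission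
  imports Defs
begin

text \<open>
  Canceling flowers sum to a normal-play zero by the Colon Principle, so trimming preserves the
  normal outcome, and it remains to compare a sum \<open>G\<close> with its evil twin. If all stems have height
  \<open>1\<close>, the misere outcome of \<open>G\<close> is the normal outcome of \<open>G + *\<close>, by induction: the only obstacle
  is a normal-play win that moves in the extra \<open>*\<close>, that is, with \<open>G \<ge> 0\<close> when Left is to move. If some
  blossom has value \<open>\<le> 0\<close>, its flower is \<open>\<le> *\<close>, and cutting that stem wins too. Otherwise red-blue
  positions never being first-player wins makes every flower \<open>\<ge> *\<close>, and according to the
  parity of their number Left wins by cutting a stem or by a blossom move that leaves a value \<open>\<ge> 0\<close>.
  If some stem is taller, the two conventions agree by induction until a player
  cuts the last tall stem to height \<open>0\<close> or \<open>1\<close>; both choices are available then, and the height-\<open>1\<close>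
  case says that exchanging them exchanges the conventions.
\<close>

section \<open>Normal play\<close>

lemma opponent_opponent [simp]: "opponent (opponent p) = p"
  by (cases p) auto

lemma options_plus [simp]:
  "options p (G + H) = (\<lambda>G'. G' + H) |`| options p G |\<union>| (\<lambda>H'. G + H') |`| options p H"
  by (cases p) auto

lemma left_summand_option: "G' |\<in>| options p G \<Longrightarrow> G' + H |\<in>| options p (G + H)"
  by simp

lemma right_summand_option: "H' |\<in>| options p H \<Longrightarrow> G + H' |\<in>| options p (G + H)"
  by simp

lemma options_zero [simp]: "options p 0 = {||}"
  by (cases p) (auto simp: zero_game_def)

text \<open>For \<open>Left\<close> this says that \<open>G\<close> is at least 0 in the normal-play
  order, for \<open>Right\<close> at most 0. Keeping the player as a parameter lets one argument
  serve both colors.\<close>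

definition survives :: "player \<Rightarrow> game \<Rightarrow> bool" where
  "survives p G \<longleftrightarrow> \<not> wins_first Normal (opponent p) G"

lemma wins_first_normal_iff:
  "wins_first Normal p G \<longleftrightarrow> (\<exists>G'. G' |\<in>| options p G \<and> survives p G')"
  by (subst wins_first.simps) (auto simp: survives_def)

lemma survives_iff:
  "survives p G \<longleftrightarrow> (\<forall>G'. G' |\<in>| options (opponent p) G \<longrightarrow> wins_first Normal p G')"
  by (auto simp: survives_def wins_first_normal_iff[of "opponent p"])

lemma wins_first_misere_iff:
  assumes "options p G \<noteq> {||}"
  shows "wins_first Misere p G \<longleftrightarrow>
    (\<exists>G'. G' |\<in>| options p G \<and> \<not> wins_first Misere (opponent p) G')"
  using assms by (subst wins_first.simps) auto

lemma wins_first_normalI: "G' |\<in>| options p G \<Longrightarrow> survives p G' \<Longrightarrow> wins_first Normal p G"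
  by (auto simp: wins_first_normal_iff)

text \<open>The second player answers in the summand where the opponent has just moved. Both halves
  are proved together, since a reply leads from the winning half back to the surviving half.\<close>

lemma normal_plus_survives:
  "(survives p G \<and> survives p H \<longrightarrow> survives p (G + H)) \<and>
   (wins_first Normal p G \<and> survives p H \<longrightarrow> wins_first Normal p (G + H))"
proof (induction "size G + size H" arbitrary: G H rule: less_induct)
  case less
  \<comment> \<open>The bound is not strict, because \<open>win\<close> first passes to a smaller
    option; so it serves for options as well as for \<open>G\<close> and \<open>H\<close>
    themselves.\<close>
  have win: "wins_first Normal p (G' + H')"
    if w: "wins_first Normal p G'" and "survives p H'" "size G' + size H' \<le> size G + size H"
    for G' H'
  proof -
    obtain K where K: "K |\<in>| options p G'" "survives p K"
      using w by (auto simp: wins_first_normal_iff)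
    have "survives p (K + H')"
      using less[of K H'] size_option[OF K(1)] K(2) that by auto
    then show ?thesis
      using K by (intro wins_first_normalI[of "K + H'"]) auto
  qed
  have "wins_first Normal p K"
    if s: "survives p G" "survives p H" and K: "K |\<in>| options (opponent p) (G + H)" for K
  proof -
    from K consider (G) G' where "G' |\<in>| options (opponent p) G" "K = G' + H"
      | (H) H' where "H' |\<in>| options (opponent p) H" "K = G + H'"
      by auto
    then show ?thesis
    proof cases
      case G
      then have "wins_first Normal p G'"
        using s by (auto simp: survives_iff)
      then show ?thesis
        using win[of G' H] s G size_option[OF G(1)] by auto
    next
      case H
      then have "wins_first Normal p H'"
        using s by (auto simp: survives_iff)
      then show ?thesis
        using win[of H' G] s H size_option[OF H(1)] by (auto simp: add.commute)
    qed
  qed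
  then show ?case
    using win[of G H] by (auto simp: survives_iff[of p "G + H"])
qed

lemma survives_plus: "survives p G \<Longrightarrow> survives p H \<Longrightarrow> survives p (G + H)"
  using normal_plus_survives by blast

lemma wins_first_plus:
  "wins_first Normal p G \<Longrightarrow> survives p H \<Longrightarrow> wins_first Normal p (G + H)"
  using normal_plus_survives by blast

text \<open>A second-player win is a normal-play zero: adding it keeps a won game won and, applied
  to the opponent, a surviving game surviving.\<close>

lemma wins_first_plus_previous_player_win:
  assumes "\<And>q. survives q Z"
  shows "wins_first Normal p (G + Z) \<longleftrightarrow> wins_first Normal p G"
  using wins_first_plus[of p G Z] survives_plus[of "opponent p" G Z] assms
  by (auto simp: survives_def simp del: opponent_opponent) (auto simp: survives_def)

lemma outcome_plus_previous_player_win: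
  assumes "\<And>q. survives q Z"
  shows "o\<^sup>+ (G + Z) = o\<^sup>+ G"
  using wins_first_plus_previous_player_win[OF assms] by (simp add: outcome_def)

text \<open>Mirror strategy: a move in one summand is answered by its mirror image in the
  other.\<close>

lemma survives_plus_uminus: "survives p (G + - G)"
proof (induction G arbitrary: p rule: game_option_induct)
  case (options G)
  have IH: "survives p (G' + - G')" if "G' |\<in>| options q G" for G' q
    using that options by (cases q) auto
  have opts: "options q (- G) = uminus |`| options (opponent q) G" for q
    by (cases q) auto
  have "wins_first Normal p K" if "K |\<in>| options (opponent p) (G + - G)" for K
  proof -
    from that consider (G) G' where "G' |\<in>| options (opponent p) G" "K = G' + - G"
      | (H) H' where "H' |\<in>| options p G" "K = G + - H'"
      by (auto simp: opts)
    then show ?thesis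
    proof cases
      case G
      then show ?thesis
        using IH[of G'] by (intro wins_first_normalI[of "G' + - G'"]) (auto simp: opts)
    next
      case H
      then show ?thesis
        using IH[of H'] by (intro wins_first_normalI[of "H' + - H'"]) (auto simp: opts)
    qed
  qed
  then show ?case
    by (auto simp: survives_iff)
qed

section \<open>Ordinal sums over nimbers\<close>

text \<open>A separate recursion for the options of a nimber, so that \<open>stemmed\<close>
  recurses on the blossom alone.\<close>

primrec nimber_opts :: "nat \<Rightarrow> game fset" where
  "nimber_opts 0 = {||}"
| "nimber_opts (Suc h) =
     finsert (Game (nimber_opts h) (nimber_opts h)) (nimber_opts h)"

text \<open>The ordinal sum \<open>*\<^sub>h : X\<close>; in particular \<open>stemmed h 0\<close> is the nimber \<open>*h\<close>.\<close>

function stemmed :: "nat \<Rightarrow> game \<Rightarrow> game" where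
  "stemmed h X = Game (nimber_opts h |\<union>| stemmed h |`| left_opts X)
                      (nimber_opts h |\<union>| stemmed h |`| right_opts X)"
  by auto
termination
  by (relation "measure (\<lambda>(h, X). size X)") (auto simp: size_left_option size_right_option)

declare stemmed.simps [simp del]

section \<open>Moves in an ordinal sum and the Colon Principle\<close>

lemma stemmed_zero: "stemmed h 0 = Game (nimber_opts h) (nimber_opts h)"
  by (subst stemmed.simps) (simp add: zero_game_def)

lemma stemmed_zero_zero [simp]: "stemmed 0 0 = 0"
  using stemmed_zero[of 0] by (simp flip: zero_game_def)

lemma nimber_opts_iff: "x |\<in>| nimber_opts h \<longleftrightarrow> (\<exists>i<h. x = stemmed i 0)"
  by (induction h) (auto simp: stemmed_zero less_Suc_eq)

lemma options_stemmed_iff: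
  "G' |\<in>| options p (stemmed h X) \<longleftrightarrow>
     (\<exists>i<h. G' = stemmed i 0) \<or> (\<exists>X'. X' |\<in>| options p X \<and> G' = stemmed h X')"
  by (subst stemmed.simps; cases p) (auto simp: nimber_opts_iff)

lemma nimber_option: "i < h \<Longrightarrow> stemmed i 0 |\<in>| options p (stemmed h X)"
  by (auto simp: options_stemmed_iff)

lemma stemmed_option: "X' |\<in>| options p X \<Longrightarrow> stemmed h X' |\<in>| options p (stemmed h X)"
  by (auto simp: options_stemmed_iff)

text \<open>The assumption on smaller heights breaks a circle: a stem cut is answered by leaving two
  equal nimbers, and that these survive is a special case of the conclusion.\<close>

lemma survives_stemmed_aux:
  assumes stalks: "\<And>i. i < h \<Longrightarrow> survives p (stemmed i 0 + stemmed i 0)"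
  shows "survives p (X + Y) \<Longrightarrow> survives p (stemmed h X + stemmed h Y)"
proof (induction "size X + size Y" arbitrary: X Y rule: less_induct)
  case less
  have reply: "wins_first Normal p (stemmed h X' + stemmed h Y')"
    if w: "wins_first Normal p (X' + Y')" and "size X' + size Y' < size X + size Y" for X' Y'
  proof -
    obtain K where K: "K |\<in>| options p (X' + Y')" "survives p K"
      using w unfolding wins_first_normal_iff by blast
    from K(1) consider (X) X'' where "X'' |\<in>| options p X'" "K = X'' + Y'"
      | (Y) Y'' where "Y'' |\<in>| options p Y'" "K = X' + Y''"
      by auto
    then show ?thesis
    proof cases
      case X
      then have "survives p (stemmed h X'' + stemmed h Y')"
        using less(1)[of X'' Y'] size_option[OF X(1)] K that by auto
      then show ?thesis
        using X by (intro wins_first_normalI[OF left_summand_option[OF stemmed_option]])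
    next
      case Y
      then have "survives p (stemmed h X' + stemmed h Y'')"
        using less(1)[of X' Y''] size_option[OF Y(1)] K that by auto
      then show ?thesis
        using Y by (intro wins_first_normalI[OF right_summand_option[OF stemmed_option]])
    qed
  qed
  have "wins_first Normal p K"
    if "K |\<in>| options (opponent p) (stemmed h X + stemmed h Y)" for K
  proof -
    from that consider (stem) i where "i < h"
        "K = stemmed i 0 + stemmed h Y \<or> K = stemmed h X + stemmed i 0"
      | (X) X' where "X' |\<in>| options (opponent p) X" "K = stemmed h X' + stemmed h Y"
      | (Y) Y' where "Y' |\<in>| options (opponent p) Y" "K = stemmed h X + stemmed h Y'"
      by (auto simp: options_stemmed_iff)
    then show ?thesis
    proof cases
      \<comment> \<open>The other stem is cut to the same height.\<close>
      case stem
      then show ?thesis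
        using stalks[of i] by (intro wins_first_normalI[of "stemmed i 0 + stemmed i 0"])
          (auto intro: left_summand_option right_summand_option nimber_option
            simp del: options_plus)
    next
      case X
      then show ?thesis
        using reply[of X' Y] less(2) size_option[OF X(1)] by (auto simp: survives_iff)
    next
      case Y
      then show ?thesis
        using reply[of X Y'] less(2) size_option[OF Y(1)] by (auto simp: survives_iff)
    qed
  qed
  then show ?case
    by (auto simp: survives_iff)
qed

lemma survives_zero [simp]: "survives p 0"
  by (simp add: survives_iff)

text \<open>The Colon Principle for equal stems, in additive form since nimbers are their own
  negatives. Strong induction on the height, with empty blossoms, discharges the assumption of the
  auxiliary lemma.\<close>

lemma colon_principle:
  assumes "survives p (X + Y)"
  shows "survives p (stemmed h X + stemmed h Y)"
proof -
  have "survives p (stemmed i 0 + stemmed i 0)" for i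
  proof (induction i rule: less_induct)
    case (less i)
    then show ?case
      by (rule survives_stemmed_aux) simp_all
  qed
  from survives_stemmed_aux[OF this assms] show ?thesis .
qed

lemma survives_nimber_nimber: "survives p (stemmed h 0 + stemmed h 0)"
  by (intro colon_principle) simp

text \<open>Seen from \<open>p\<close>, \<open>X\<close> is at most 0, so by the Colon Principle the
  flower is at most its bare stem. Adding flower plus nimber to a supposed win of the opponent
  leaves two equal nimbers to cancel.\<close>

lemma survives_replace_by_nimber:
  assumes "survives p (G + stemmed h X)" and "survives (opponent p) X"
  shows "survives p (G + stemmed h 0)"
proof (rule ccontr)
  assume "\<not> survives p (G + stemmed h 0)"
  then have "wins_first Normal (opponent p) (G + stemmed h 0)"
    by (simp add: survives_def)
  then have "wins_first Normal (opponent p) ((G + stemmed h 0) + (stemmed h X + stemmed h 0))"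
    by (rule wins_first_plus[OF _ colon_principle]) (simp add: assms(2))
  moreover have "survives p ((G + stemmed h X) + (stemmed h 0 + stemmed h 0))"
    by (rule survives_plus[OF assms(1) survives_nimber_nimber])
  ultimately show False
    by (simp add: survives_def ac_simps)
qed

section \<open>Sums of ordinal sums\<close>

text \<open>The trait of red-blue blossoms that the argument needs: no position reachable by moves
  in any order is a first-player win. Being hereditary, it is kept by blossom moves.\<close>

inductive never_fuzzy :: "game \<Rightarrow> bool" where
  "(\<And>p X'. X' |\<in>| options p X \<Longrightarrow> never_fuzzy X') \<Longrightarrow>
   (\<And>p. wins_first Normal p X \<Longrightarrow> survives p X) \<Longrightarrow> never_fuzzy X"

lemma never_fuzzy_option: "never_fuzzy X \<Longrightarrow> X' |\<in>| options p X \<Longrightarrow> never_fuzzy X'"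
  by (erule never_fuzzy.cases) blast

lemma never_fuzzy_survives: "never_fuzzy X \<Longrightarrow> wins_first Normal p X \<Longrightarrow> survives p X"
  by (erule never_fuzzy.cases) blast

lemma never_fuzzy_zero: "never_fuzzy 0"
  by (rule never_fuzzy.intros) auto

text \<open>A pair \<open>(h, X)\<close> stands for \<open>*\<^sub>h : X\<close>. A stem cut at the ground leaves the
  component \<open>(0, 0)\<close>, which is why height \<open>0\<close> is admitted.\<close>

definition bed_sum :: "(nat \<times> game) multiset \<Rightarrow> game" where
  "bed_sum M = (\<Sum>c\<in>#M. stemmed (fst c) (snd c))"

lemma bed_sum_empty [simp]: "bed_sum {#} = 0"
  by (simp add: bed_sum_def)

lemma bed_sum_add [simp]: "bed_sum (add_mset c M) = stemmed (fst c) (snd c) + bed_sum M"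
  by (simp add: bed_sum_def)

definition valid :: "(nat \<times> game) multiset \<Rightarrow> bool" where
  "valid M \<longleftrightarrow> (\<forall>c\<in>#M. never_fuzzy (snd c) \<and> (fst c = 0 \<longrightarrow> snd c = 0))"

lemma valid_add [simp]:
  "valid (add_mset c M) \<longleftrightarrow> never_fuzzy (snd c) \<and> (fst c = 0 \<longrightarrow> snd c = 0) \<and> valid M"
  by (auto simp: valid_def)

definition short :: "(nat \<times> game) multiset \<Rightarrow> bool" where
  "short M \<longleftrightarrow> (\<forall>c\<in>#M. fst c \<le> 1)"

lemma short_add [simp]: "short (add_mset c M) \<longleftrightarrow> fst c \<le> 1 \<and> short M"
  by (auto simp: short_def)

section \<open>Moves in a bed, and its misere outcome\<close>

lemma options_bed_sumE:
  assumes "G' |\<in>| options p (bed_sum M)"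
  obtains h X N g where "M = add_mset (h, X) N" "g |\<in>| options p (stemmed h X)"
    "G' = g + bed_sum N"
  using assms
proof (induction M arbitrary: G' thesis)
  case empty
  then show ?case by simp
next
  case (add c M)
  obtain h X where c: "c = (h, X)"
    by (cases c)
  from add.prems(2) consider (head) g where "g |\<in>| options p (stemmed h X)" "G' = g + bed_sum M"
    | (tail) K where "K |\<in>| options p (bed_sum M)" "G' = stemmed h X + K"
    by (auto simp: c)
  then show ?case
  proof cases
    case head
    then show ?thesis
      using add.prems(1)[of h X M g] c by simp
  next
    case tail
    from add.IH[OF _ tail(1)] obtain h' X' N g
      where *: "M = add_mset (h', X') N" "g |\<in>| options p (stemmed h' X')" "K = g + bed_sum N"
      by blast
    show ?thesis
      by (rule add.prems(1)[of h' X' "add_mset c N" g])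
        (use * tail(2) c in \<open>auto simp: ac_simps add_mset_commute\<close>)
  qed
qed

lemma options_bed_sum_cases:
  assumes "G' |\<in>| options p (bed_sum M)" and "valid M"
  obtains (stem) h X N i where "M = add_mset (h, X) N" "i < h" "G' = bed_sum (add_mset (i, 0) N)"
      "valid (add_mset (i, 0) N)"
    | (blossom) h X N X' where "M = add_mset (h, X) N" "X' |\<in>| options p X"
      "G' = bed_sum (add_mset (h, X') N)" "valid (add_mset (h, X') N)"
proof -
  from assms(1) obtain h X N g where *: "M = add_mset (h, X) N"
    "g |\<in>| options p (stemmed h X)" "G' = g + bed_sum N"
    by (rule options_bed_sumE)
  from *(2) consider (stem) i where "i < h" "g = stemmed i 0"
    | (blossom) X' where "X' |\<in>| options p X" "g = stemmed h X'"
    by (auto simp: options_stemmed_iff)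
  then show ?thesis
  proof cases
    case stem
    then show ?thesis
      using assms(2) * by (intro that(1)[of h X N i]) (auto intro: never_fuzzy_zero)
  next
    case blossom
    then show ?thesis
      using assms(2) * by (intro that(2)[of h X N X']) (auto intro: never_fuzzy_option)
  qed
qed

lemma stem_option:
  "i < h \<Longrightarrow> bed_sum (add_mset (i, 0) N) |\<in>| options p (bed_sum (add_mset (h, X) N))"
  using nimber_option by (simp del: options_plus add: left_summand_option)

lemma blossom_option:
  "X' |\<in>| options p X \<Longrightarrow>
   bed_sum (add_mset (h, X') N) |\<in>| options p (bed_sum (add_mset (h, X) N))"
  by (simp del: options_plus add: left_summand_option stemmed_option)

text \<open>From the viewpoint of \<open>p\<close> each flower is at least a star, so the bed is at
  least 0 or at least a star, according to the parity of the number of components of height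
  1.\<close>

lemma survives_short_or_plus_star:
  assumes "short M" "valid M" "\<And>X. (1, X) \<in># M \<Longrightarrow> survives p X"
  shows "survives p (bed_sum M) \<or> survives p (bed_sum M + stemmed 1 0)"
  using assms
proof (induction M)
  case empty
  then show ?case by simp
next
  case (add c M)
  then have IH: "survives p (bed_sum M) \<or> survives p (bed_sum M + stemmed 1 0)"
    by simp
  show ?case
  proof (cases "fst c = 0")
    case True
    then show ?thesis
      using IH add.prems by simp
  next
    case False
    then obtain X where c: "c = (1, X)"
      using add.prems by (cases c) auto
    then have "survives p X"
      using add.prems by simp
    then have X: "survives p (stemmed 1 X + stemmed 1 0)"
      by (intro colon_principle) simp
    show ?thesis
      using IH
    proof
      assume "survives p (bed_sum M)"
      from survives_plus[OF this X] show ?thesis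
        by (simp add: c ac_simps)
    next
      assume *: "survives p (bed_sum M + stemmed 1 0)"
      from survives_plus[OF * X]
      have "survives p ((stemmed 1 X + bed_sum M) + (stemmed 1 0 + stemmed 1 0))"
        by (simp add: ac_simps)
      then have "survives p (stemmed 1 X + bed_sum M)"
        using wins_first_plus_previous_player_win[OF survives_nimber_nimber]
        by (simp add: survives_def)
      then show ?thesis
        by (simp add: c)
    qed
  qed
qed

text \<open>In the bed plus a star, \<open>p\<close> may win by removing the star, a move that the
  misere game on the bed lacks. This provides a winning move inside the bed instead.\<close>

lemma short_alternative_to_star:
  assumes "short M" "valid M" "(1, X\<^sub>0) \<in># M" "survives p (bed_sum M)"
  shows "\<exists>G'. G' |\<in>| options p (bed_sum M) \<and> survives p (G' + stemmed 1 0)"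
proof (cases "\<exists>X. (1, X) \<in># M \<and> \<not> wins_first Normal p X")
  \<comment> \<open>A blossom is at most 0 for \<open>p\<close>: its flower is at most a star, so
    cutting its stem and keeping the extra star loses nothing.\<close>
  case True
  then obtain X N where M: "M = add_mset (1, X) N" and X: "survives (opponent p) X"
    by (auto simp: survives_def dest: multi_member_split)
  have "survives p (bed_sum N + stemmed 1 0)"
    using assms(4) X by (intro survives_replace_by_nimber[of p _ 1 X]) (auto simp: M ac_simps)
  then show ?thesis
    using stem_option[of 0 1 N p X] by (auto simp: M)
next
  case False
  obtain N where M: "M = add_mset (1, X\<^sub>0) N"
    using assms(3) by (auto dest: multi_member_split)
  \<comment> \<open>With no such blossom, \<open>never_fuzzy\<close> makes every blossom at least 0
    for \<open>p\<close>.\<close>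
  have "survives p X" if "(1, X) \<in># N" for X
  proof (rule never_fuzzy_survives)
    show "never_fuzzy X"
      using that assms(2) by (auto simp: valid_def M)
    show "wins_first Normal p X"
      using False that M by auto
  qed
  then have "survives p (bed_sum N) \<or> survives p (bed_sum N + stemmed 1 0)"
    using assms by (intro survives_short_or_plus_star) (auto simp: M)
  then show ?thesis
  proof
    \<comment> \<open>The remaining flowers suffice alone: a blossom move to \<open>X'\<close>,
      still at least 0, lets the last flower balance the extra star.\<close>
    assume N: "survives p (bed_sum N)"
    have "wins_first Normal p X\<^sub>0"
      using False assms(3) by auto
    then obtain X' where X': "X' |\<in>| options p X\<^sub>0" "survives p X'"
      by (auto simp: wins_first_normal_iff)
    then have "survives p (stemmed 1 X' + stemmed 1 0)"
      by (intro colon_principle) simp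
    from survives_plus[OF N this]
    have "survives p (bed_sum (add_mset (1, X') N) + stemmed 1 0)"
      by (simp add: ac_simps)
    then show ?thesis
      using blossom_option[OF X'(1), of 1 N] M by blast
  next
    assume "survives p (bed_sum N + stemmed 1 0)"
    then show ?thesis
      using stem_option[of 0 1 N p X\<^sub>0] by (auto simp: M)
  qed
qed

text \<open>Moves inside the bed match by induction. While a stem is left, the one unmatched move,
  removing the star, is never the only winning one by
  \<open>short_alternative_to_star\<close>.\<close>

lemma misere_short:
  assumes "short M" "valid M"
  shows "wins_first Misere p (bed_sum M) \<longleftrightarrow> wins_first Normal p (bed_sum M + stemmed 1 0)"
  using assms
proof (induction "size (bed_sum M)" arbitrary: M p rule: less_induct)
  case less
  have star: "options p (stemmed (Suc 0) 0) = {|0|}"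
    by (rule fset_eqI) (auto simp: options_stemmed_iff)
  show ?case
  proof (cases "\<exists>X. (1, X) \<in># M")
    \<comment> \<open>No stem is left, so the mover wins both games: the empty one under misere
      play, the star by removing it.\<close>
    case False
    have "stemmed (fst c) (snd c) = 0" if "c \<in># M" for c
    proof -
      have "fst c \<noteq> 1"
        using False that by (metis prod.collapse)
      then have "fst c = 0"
        using less.prems that by (force simp: short_def)
      then show ?thesis
        using less.prems that by (simp add: valid_def)
    qed
    then have "bed_sum M = 0"
      unfolding bed_sum_def by (simp cong: image_mset_cong)
    moreover have "wins_first Normal p (stemmed 1 0)"
      by (rule wins_first_normalI[of 0]) (simp_all add: star)
    moreover have "wins_first Misere p 0"
      by (subst wins_first.simps) simp
    ultimately show ?thesis
      by simp
  next
    case True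
    then obtain X where X: "(1, X) \<in># M" ..
    then obtain N where M: "M = add_mset (1, X) N"
      by (auto dest: multi_member_split)
    have "options p (bed_sum M) \<noteq> {||}"
      using stem_option[of 0 1 N p X] by (auto simp: M)
    moreover have "\<not> wins_first Misere (opponent p) G' \<longleftrightarrow> survives p (G' + stemmed 1 0)"
      if G': "G' |\<in>| options p (bed_sum M)" for G'
    proof -
      from G' less.prems(2) obtain M' where "G' = bed_sum M'" "short M'" "valid M'"
      proof (cases rule: options_bed_sum_cases)
        case (stem h X N i)
        then show ?thesis
          using less.prems(1) that[of "add_mset (i, 0) N"] by simp
      next
        case (blossom h X N X')
        then show ?thesis
          using less.prems(1) that[of "add_mset (h, X') N"] by simp
      qed
      then show ?thesis
        using less.hyps[of M'] size_option[OF G'] by (simp add: survives_def)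
    qed
    ultimately have "wins_first Misere p (bed_sum M) \<longleftrightarrow>
        (\<exists>G'. G' |\<in>| options p (bed_sum M) \<and> survives p (G' + stemmed 1 0))"
      by (auto simp: wins_first_misere_iff)
    also have "\<dots> \<longleftrightarrow> wins_first Normal p (bed_sum M + stemmed 1 0)"
      using short_alternative_to_star[OF less.prems X, of p]
      by (auto simp: wins_first_normal_iff star)
    finally show ?thesis .
  qed
qed

text \<open>The conventions can differ only after a move that makes the bed short, that is, cuts the
  last tall stem to height 0 or 1. By \<open>misere_short\<close> these two heights exchange the
  conventions, and the player may choose either.\<close>

lemma misere_tall:
  assumes "\<not> short M" "valid M"
  shows "wins_first Misere p (bed_sum M) \<longleftrightarrow> wins_first Normal p (bed_sum M)"
  using assms
proof (induction "size (bed_sum M)" arbitrary: M p rule: less_induct)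
  case less
  let ?mis = "\<lambda>G'. \<not> wins_first Misere (opponent p) G'"
  \<comment> \<open>Each option gets a partner for which the conventions trade places, which is
    enough for existential statements. An option that stays tall is its own partner.\<close>
  have swap: "\<exists>G''. G'' |\<in>| options p (bed_sum M) \<and> (?mis G' \<longleftrightarrow> survives p G'') \<and>
      (survives p G' \<longleftrightarrow> ?mis G'')"
    if G': "G' |\<in>| options p (bed_sum M)" for G'
  proof -
    have tall: ?thesis if "G' = bed_sum M'" "\<not> short M'" "valid M'" for M'
      using less.hyps[of M' "opponent p"] that G' size_option[OF G'] by (auto simp: survives_def)
    \<comment> \<open>Changing the height between 0 and 1 supplies or cancels the star from
      \<open>misere_short\<close>.\<close>
    have twin: "?mis (bed_sum (add_mset (i, 0) N)) \<longleftrightarrow> survives p (bed_sum (add_mset (1 - i, 0) N))"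
      if "short N" "valid N" "i \<le> 1" for i N
    proof -
      have "?mis (bed_sum (add_mset (i, 0) N)) \<longleftrightarrow>
          survives p (bed_sum (add_mset (i, 0) N) + stemmed 1 0)"
        using that by (subst misere_short) (auto simp: survives_def never_fuzzy_zero)
      also have "\<dots> \<longleftrightarrow> survives p (bed_sum (add_mset (1 - i, 0) N))"
      proof (cases "i = 0")
        case True
        then show ?thesis by (simp add: ac_simps)
      next
        case False
        then have "i = 1"
          using that by simp
        then show ?thesis
          using wins_first_plus_previous_player_win[OF survives_nimber_nimber, of _ "bed_sum N" 1]
          by (simp add: survives_def ac_simps)
      qed
      finally show ?thesis .
    qed
    from G' less.prems(2) show ?thesis
    proof (cases rule: options_bed_sum_cases)
      case (stem h X N i)
      show ?thesis
      proof (cases "short (add_mset (i, 0) N)")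
        case False
        then show ?thesis using tall stem by blast
      next
        case True
        then have i: "i \<le> 1" "short N" "valid N"
          using stem by auto
        \<comment> \<open>The bed was tall and the remainder is short, so \<open>h\<close> is at
          least 2.\<close>
        then have h: "1 - i < h"
          using less.prems(1) stem(1) by auto
        show ?thesis
          using twin[of N i] twin[of N "1 - i"] i stem_option[OF h, of N p X] stem
          by (intro exI[of _ "bed_sum (add_mset (1 - i, 0) N)"]) (simp del: bed_sum_add)
      qed
    next
      case (blossom h X N X')
      then show ?thesis
        using tall[of "add_mset (h, X') N"] less.prems(1) by simp
    qed
  qed
  obtain h X where "(h, X) \<in># M" "0 < h"
    using less.prems(1) by (force simp: short_def)
  then obtain N where "M = add_mset (h, X) N" "0 < h"
    by (auto dest: multi_member_split)
  then have "options p (bed_sum M) \<noteq> {||}"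
    using stem_option[of 0 h N p X] by auto
  then show ?case
    unfolding wins_first_misere_iff[OF \<open>options p (bed_sum M) \<noteq> {||}\<close>]
      wins_first_normal_iff
    using swap by blast
qed

section \<open>Hackenbush\<close>

lemma adjacency_mono: "edges G \<subseteq># edges H \<Longrightarrow> adjacency G \<subseteq> adjacency H"
  by (auto simp: adjacency_def dest: mset_subset_eqD)

lemma grounded_mono:
  assumes "ground G = ground H" "edges G \<subseteq># edges H"
  shows "grounded G \<subseteq> grounded H"
  using rtrancl_mono[OF adjacency_mono[OF assms(2)]] assms(1) by (auto simp: grounded_def)

lemma ground_subset_grounded: "ground G \<subseteq> grounded G"
  by (auto simp: grounded_def)

lemma grounded_step: "u \<in> grounded G \<Longrightarrow> (u, v) \<in> adjacency G \<Longrightarrow> v \<in> grounded G"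
  by (auto simp: grounded_def intro: rtrancl_into_rtrancl)

lemma adjacency_sym: "(u, v) \<in> adjacency G \<Longrightarrow> (v, u) \<in> adjacency G"
  by (auto simp: adjacency_def)

lemma edge_adjacency: "e \<in># edges G \<Longrightarrow> (end1 e, end2 e) \<in> adjacency G"
  by (cases e) (auto simp: adjacency_def)

lemma grounded_end1_iff_end2:
  "e \<in># edges G \<Longrightarrow> end1 e \<in> grounded G \<longleftrightarrow> end2 e \<in> grounded G"
  using edge_adjacency adjacency_sym grounded_step by blast

lemma adjacencyE:
  assumes "(u, v) \<in> adjacency G"
  obtains e where "e \<in># edges G" "end1 e = u \<and> end2 e = v \<or> end1 e = v \<and> end2 e = u"
  using assms by (force simp: adjacency_def)

lemma grounded_subsetI:
  assumes "ground G \<subseteq> A" "\<And>e. e \<in># edges G \<Longrightarrow> end1 e \<in> A \<longleftrightarrow> end2 e \<in> A"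
  shows "grounded G \<subseteq> A"
proof -
  have "v \<in> A" if "(u, v) \<in> (adjacency G)\<^sup>*" "u \<in> A" for u v
    using that
  proof (induction rule: rtrancl_induct)
    case (step v w)
    then show ?case
      using assms(2) by (metis adjacencyE)
  qed
  then show ?thesis
    using assms(1) by (auto simp: grounded_def)
qed

lemma ground_discard [simp]: "ground (discard_disconnected G) = ground G"
  by (simp add: discard_disconnected_def)

lemma edges_discard:
  "edges (discard_disconnected G) = {#e \<in># edges G. end1 e \<in> grounded G \<and> end2 e \<in> grounded G#}"
  by (simp add: discard_disconnected_def)

lemma grounded_discard [simp]: "grounded (discard_disconnected G) = grounded G"
proof
  show "grounded (discard_disconnected G) \<subseteq> grounded G"
    by (intro grounded_mono) (auto simp: edges_discard)
  \<comment> \<open>Intersecting with \<open>grounded G\<close> settles the discarded edges: neither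
    endpoint lies in the set.\<close>
  have "grounded G \<subseteq> grounded (discard_disconnected G) \<inter> grounded G"
  proof (intro grounded_subsetI)
    fix e assume e: "e \<in># edges G"
    show "end1 e \<in> grounded (discard_disconnected G) \<inter> grounded G \<longleftrightarrow>
      end2 e \<in> grounded (discard_disconnected G) \<inter> grounded G"
      using grounded_end1_iff_end2[OF e] grounded_end1_iff_end2[of e "discard_disconnected G"] e
      by (auto simp: edges_discard)
  qed (use ground_subset_grounded[of "discard_disconnected G"] ground_subset_grounded[of G] in auto)
  then show "grounded G \<subseteq> grounded (discard_disconnected G)"
    by simp
qed

text \<open>Discarding does not shrink the grounded set, so that of \<open>H\<close> is squeezed
  between two equal sets.\<close>

lemma discard_between:
  assumes "ground H = ground G" "edges (discard_disconnected G) \<subseteq># edges H"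
    "edges H \<subseteq># edges G"
  shows "discard_disconnected H = discard_disconnected G"
proof -
  have gr: "grounded H = grounded G"
    using grounded_mono[of H G] grounded_mono[of "discard_disconnected G" H] assms by auto
  have "edges (discard_disconnected H) \<subseteq># edges (discard_disconnected G)"
    using assms(3) unfolding edges_discard gr by (rule multiset_filter_mono)
  moreover have "edges (discard_disconnected G) \<subseteq># edges (discard_disconnected H)"
    using multiset_filter_mono[OF assms(2), of "\<lambda>e. end1 e \<in> grounded G \<and> end2 e \<in> grounded G"]
    by (simp add: edges_discard gr filter_filter_mset)
  ultimately show ?thesis
    using assms(1) by (intro hackenbush.expand) (simp add: subset_mset.antisym)
qed

section \<open>Successive cuts\<close>

lemma ground_cut [simp]: "ground (cut e G) = ground G"
  by (simp add: cut_def)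

lemma edges_discard_subset: "edges (discard_disconnected G) \<subseteq># edges G"
  unfolding edges_discard by (rule multiset_filter_subset)

lemma discard_discard [simp]:
  "discard_disconnected (discard_disconnected G) = discard_disconnected G"
  by (rule discard_between) (simp_all add: edges_discard_subset)

lemma discard_cut: "discard_disconnected (cut e G) = cut e G"
  by (simp add: cut_def)

text \<open>The discard after the first cut removes only edges that the final discard would remove
  as well, so by \<open>discard_between\<close> it can be postponed.\<close>

lemma cut_cut:
  "cut b (cut e G) = discard_disconnected (Hackenbush (ground G) (edges G - {#e#} - {#b#}))"
proof -
  define H where "H = Hackenbush (ground G) (edges G - {#e#})"
  define K where "K = Hackenbush (ground G) (edges H - {#b#})"
  have cut_H: "cut e G = discard_disconnected H"
    by (simp add: cut_def H_def)
  have KH: "edges K \<subseteq># edges H"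
    by (simp add: K_def)
  have gr: "grounded K \<subseteq> grounded H"
    using KH by (intro grounded_mono) (auto simp: K_def H_def)
  have "edges (discard_disconnected K) \<subseteq># edges (discard_disconnected H) - {#b#}"
    unfolding subseteq_mset_def
  proof
    fix x
    show "count (edges (discard_disconnected K)) x \<le> count (edges (discard_disconnected H) - {#b#}) x"
      using gr by (auto simp: edges_discard K_def simp del: filter_diff_mset)
  qed
  moreover have "edges (discard_disconnected H) - {#b#} \<subseteq># edges K"
    unfolding K_def hackenbush.sel by (rule subset_eq_diff_conv[THEN iffD2])
      (meson edges_discard_subset mset_subset_eq_add_left subset_mset.order_trans
        subset_eq_diff_conv subset_mset.order_refl)
  ultimately have "discard_disconnected (Hackenbush (ground G) (edges (discard_disconnected H) - {#b#})) =
      discard_disconnected K"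
    by (intro discard_between) (simp_all add: K_def)
  then show ?thesis
    by (simp add: cut_def[of b] cut_H K_def) (simp add: H_def)
qed

lemma cut_commute: "cut b (cut e G) = cut e (cut b G)"
  by (simp add: cut_cut add_mset_commute)

lemma cut_absent: "e \<notin># edges G \<Longrightarrow> discard_disconnected G = G \<Longrightarrow> cut e G = G"
  by (cases G) (simp add: cut_def diff_single_trivial)

text \<open>If cutting either edge made the other fall, both cuts would leave the same graph, and
  then neither edge could be holding up the other.\<close>

lemma mem_cut_or_mem_cut:
  assumes G: "discard_disconnected G = G" and e: "e \<in># edges G" and r: "r \<in># edges G" and "e \<noteq> r"
    and notin: "r \<notin># edges (cut e G)"
  shows "e \<in># edges (cut r G)"
proof (rule ccontr)
  assume "e \<notin># edges (cut r G)"
  then have "cut r G = cut e (cut r G)"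
    by (simp add: cut_absent discard_cut)
  also have "\<dots> = cut e G"
    using notin by (simp add: cut_commute[of e] cut_absent discard_cut)
  finally have eq: "cut r G = cut e G" .
  let ?E = "Hackenbush (ground G) (edges G - {#e#})" and ?R = "Hackenbush (ground G) (edges G - {#r#})"
  have gr: "grounded ?E = grounded ?R"
    using arg_cong[OF eq, of grounded] by (simp add: cut_def)
  \<comment> \<open>Both deletions ground the same vertices, so this set is closed under
    \<open>r\<close> too: \<open>r\<close> is still present when only \<open>e\<close> is
    deleted.\<close>
  have "grounded G \<subseteq> grounded ?R"
  proof (rule grounded_subsetI)
    show "ground G \<subseteq> grounded ?R"
      using ground_subset_grounded[of ?R] by simp
    fix x assume x: "x \<in># edges G"
    show "end1 x \<in> grounded ?R \<longleftrightarrow> end2 x \<in> grounded ?R"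
    proof (cases "x = r")
      case True
      then have "x \<in># edges ?E"
        using x \<open>e \<noteq> r\<close> by (simp add: in_diff_count)
      from grounded_end1_iff_end2[OF this] show ?thesis
        by (simp add: gr)
    next
      case False
      then have "x \<in># edges ?R"
        using x by (simp add: in_diff_count)
      from grounded_end1_iff_end2[OF this] show ?thesis .
    qed
  qed
  moreover have "end1 e \<in> grounded G" "end2 e \<in> grounded G"
    using e by (subst (asm) G[symmetric], simp add: edges_discard)+
  moreover have "e \<in># edges G - {#r#}"
    using e \<open>e \<noteq> r\<close> by (simp add: in_diff_count)
  ultimately have "e \<in># edges (cut r G)"
    by (auto simp: cut_def edges_discard simp del: filter_diff_mset)
  then show False
    using \<open>e \<notin># edges (cut r G)\<close> by simp
qed

section \<open>Red-blue positions are never first-player wins\<close>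

lemma options_hackenbush:
  "options p (hackenbush_game G) = (\<lambda>e. hackenbush_game (cut e G)) |`| cuttable p G"
  by (cases p) (subst hackenbush_game.simps, simp)+

lemma options_hackenbush_iff:
  "X |\<in>| options p (hackenbush_game G) \<longleftrightarrow>
     (\<exists>e. e |\<in>| cuttable p G \<and> X = hackenbush_game (cut e G))"
  by (auto simp: options_hackenbush)

lemma cut_option:
  "e |\<in>| cuttable p G \<Longrightarrow> hackenbush_game (cut e G) |\<in>| options p (hackenbush_game G)"
  by (auto simp: options_hackenbush)

lemma edges_cut_subset: "e' \<in># edges (cut e G) \<Longrightarrow> e' \<in># edges G"
  by (auto simp: cut_def edges_discard dest: in_diffD)

lemma red_blue_cut: "red_blue G \<Longrightarrow> red_blue (cut e G)"
  by (auto simp: red_blue_def dest: edges_cut_subset)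

lemma cuttable_opponent_distinct:
  "red_blue G \<Longrightarrow> e |\<in>| cuttable p G \<Longrightarrow> r |\<in>| cuttable (opponent p) G \<Longrightarrow> e \<noteq> r"
  by (cases p) (auto simp: red_blue_def cuttable_iff)

text \<open>\<open>p\<close> plays in \<open>G\<close> as if \<open>e\<close> were already cut. If
  the opponent cuts an edge that is missing there, \<open>e\<close> is still standing and
  \<open>p\<close> cuts it, reaching that position.\<close>

lemma red_blue_cut_le:
  assumes "discard_disconnected G = G" "red_blue G" "e |\<in>| cuttable p G"
  shows "(survives p (hackenbush_game (cut e G)) \<longrightarrow> survives p (hackenbush_game G)) \<and>
    (wins_first Normal p (hackenbush_game (cut e G)) \<longrightarrow> wins_first Normal p (hackenbush_game G))"
  using assms
proof (induction "size (edges G)" arbitrary: G rule: less_induct)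
  case less
  note G = less.prems(1) and rb = less.prems(2) and e = less.prems(3)
  have IH: "(survives p (hackenbush_game (cut x (cut e G))) \<longrightarrow> survives p (hackenbush_game (cut x G))) \<and>
    (wins_first Normal p (hackenbush_game (cut x (cut e G))) \<longrightarrow>
      wins_first Normal p (hackenbush_game (cut x G)))"
    if x: "x |\<in>| cuttable q G" for x q
  proof (cases "e \<in># edges (cut x G)")
    case True
    then have "e |\<in>| cuttable p (cut x G)"
      using e by (simp add: cuttable_iff)
    from less.hyps[OF size_cut[OF x] discard_cut red_blue_cut[OF rb] this] show ?thesis
      by (simp add: cut_commute)
  next
    \<comment> \<open>Here \<open>e\<close> falls with \<open>x\<close>, so the two positions
      coincide.\<close>
    case False
    then have "cut x (cut e G) = cut x G"
      by (simp add: cut_commute[of x] cut_absent discard_cut)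
    then show ?thesis
      by simp
  qed
  have "survives p (hackenbush_game G)" if s: "survives p (hackenbush_game (cut e G))"
    unfolding survives_iff
  proof (intro allI impI)
    fix X assume "X |\<in>| options (opponent p) (hackenbush_game G)"
    then obtain r where r: "r |\<in>| cuttable (opponent p) G" and X: "X = hackenbush_game (cut r G)"
      by (auto simp: options_hackenbush_iff)
    show "wins_first Normal p X"
    proof (cases "r \<in># edges (cut e G)")
      case True
      then have "r |\<in>| cuttable (opponent p) (cut e G)"
        using r by (simp add: cuttable_iff)
      then have "wins_first Normal p (hackenbush_game (cut r (cut e G)))"
        using s cut_option by (auto simp: survives_iff)
      then show ?thesis
        using IH[OF r] X by simp
    next
      case False
      have "e \<in># edges (cut r G)"
        by (rule mem_cut_or_mem_cut[OF G _ _ cuttable_opponent_distinct[OF rb e r] False])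
          (use e r in \<open>auto simp: cuttable_iff\<close>)
      then have "e |\<in>| cuttable p (cut r G)"
        using e by (simp add: cuttable_iff)
      moreover have "cut e (cut r G) = cut e G"
        using False by (simp add: cut_commute[of e] cut_absent discard_cut)
      ultimately show ?thesis
        using cut_option s X by (metis wins_first_normalI)
    qed
  qed
  moreover have "wins_first Normal p (hackenbush_game G)"
    if w: "wins_first Normal p (hackenbush_game (cut e G))"
  proof -
    obtain b where b: "b |\<in>| cuttable p (cut e G)"
      and s: "survives p (hackenbush_game (cut b (cut e G)))"
      using w by (auto simp: wins_first_normal_iff options_hackenbush_iff)
    have b': "b |\<in>| cuttable p G"
      using b edges_cut_subset by (auto simp: cuttable_iff)
    then show ?thesis
      using IH[OF b'] s cut_option by (blast intro: wins_first_normalI)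
  qed
  ultimately show ?case
    by blast
qed

text \<open>A winning first move cuts an edge of one's own, and by \<open>red_blue_cut_le\<close>
  whoever survives after it survives already before it.\<close>

lemma never_fuzzy_hackenbush:
  "discard_disconnected G = G \<Longrightarrow> red_blue G \<Longrightarrow> never_fuzzy (hackenbush_game G)"
proof (induction "size (edges G)" arbitrary: G rule: less_induct)
  case less
  show ?case
  proof (rule never_fuzzy.intros)
    fix p X assume "X |\<in>| options p (hackenbush_game G)"
    then show "never_fuzzy X"
      using less.hyps size_cut discard_cut red_blue_cut[OF less.prems(2)]
      by (auto simp: options_hackenbush_iff)
  next
    fix p assume "wins_first Normal p (hackenbush_game G)"
    then show "survives p (hackenbush_game G)"
      using red_blue_cut_le[OF less.prems]
      by (auto simp: wins_first_normal_iff options_hackenbush_iff)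
  qed
qed

section \<open>Flowers as ordinal sums\<close>

lemma mem_stem_iff: "e \<in># stem h \<longleftrightarrow> (\<exists>i<h. e = Edge Green i (Suc i))"
  by (auto simp: stem_def)

lemma attach_sel [simp]:
  "ecolor (attach_edge h B e) = ecolor e"
  "end1 (attach_edge h B e) = attach_vertex h B (end1 e)"
  "end2 (attach_edge h B e) = attach_vertex h B (end2 e)"
  by (simp_all add: attach_edge_def)

lemma attach_vertex_ge: "h \<le> attach_vertex h B v"
  by (simp add: attach_vertex_def)

lemma ground_flower [simp]: "ground (flower_graph h B) = {0}"
  by (simp add: flower_graph_def)

lemma edges_flower: "edges (flower_graph h B) = stem h + image_mset (attach_edge h B) (edges B)"
  by (simp add: flower_graph_def)

lemma stem_grounded: "i \<le> h \<Longrightarrow> i \<in> grounded (flower_graph h B)"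
proof (induction i)
  case 0
  then show ?case
    using ground_subset_grounded[of "flower_graph h B"] by simp
next
  case (Suc i)
  then have "Edge Green i (Suc i) \<in># edges (flower_graph h B)"
    by (simp add: edges_flower mem_stem_iff)
  from grounded_end1_iff_end2[OF this] show ?case
    using Suc by simp
qed

lemma attach_vertex_grounded_iff:
  "attach_vertex h B v \<in> grounded (flower_graph h B) \<longleftrightarrow> v \<in> grounded B"
proof
  assume v: "attach_vertex h B v \<in> grounded (flower_graph h B)"
  \<comment> \<open>\<open>attach_vertex\<close> merges only ground vertices of \<open>B\<close>,
    all of them grounded, so membership in \<open>A\<close> reflects grounding exactly.\<close>
  define A where "A = {..h} \<union> attach_vertex h B ` grounded B"
  have A_iff: "attach_vertex h B v \<in> A \<longleftrightarrow> v \<in> grounded B" for v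
    using ground_subset_grounded[of B] by (auto simp: A_def attach_vertex_def split: if_splits)
  have "grounded (flower_graph h B) \<subseteq> A"
  proof (rule grounded_subsetI)
    show "ground (flower_graph h B) \<subseteq> A"
      by (simp add: A_def)
    fix e assume "e \<in># edges (flower_graph h B)"
    then consider i where "i < h" "e = Edge Green i (Suc i)"
      | e' where "e' \<in># edges B" "e = attach_edge h B e'"
      by (auto simp: edges_flower mem_stem_iff)
    then show "end1 e \<in> A \<longleftrightarrow> end2 e \<in> A"
    proof cases
      case 1
      then show ?thesis
        by (simp add: A_def)
    next
      case 2
      then show ?thesis
        using grounded_end1_iff_end2[OF 2(1)] by (simp add: A_iff)
    qed
  qed
  then show "v \<in> grounded B"
    using v A_iff by blast
next
  have "grounded B \<subseteq> {v. attach_vertex h B v \<in> grounded (flower_graph h B)}"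
  proof (rule grounded_subsetI)
    show "ground B \<subseteq> {v. attach_vertex h B v \<in> grounded (flower_graph h B)}"
      using stem_grounded[of h h B] by (auto simp: attach_vertex_def)
    fix e assume "e \<in># edges B"
    then have "attach_edge h B e \<in># edges (flower_graph h B)"
      by (simp add: edges_flower)
    from grounded_end1_iff_end2[OF this]
    show "end1 e \<in> {v. attach_vertex h B v \<in> grounded (flower_graph h B)} \<longleftrightarrow>
      end2 e \<in> {v. attach_vertex h B v \<in> grounded (flower_graph h B)}"
      by simp
  qed
  then show "v \<in> grounded B \<Longrightarrow> attach_vertex h B v \<in> grounded (flower_graph h B)"
    by blast
qed

lemma attach_edge_cong: "ground B = ground B' \<Longrightarrow> attach_edge h B = attach_edge h B'"
  by (simp add: fun_eq_iff attach_edge_def attach_vertex_def)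

lemma discard_flower:
  "discard_disconnected (flower_graph h B) = flower_graph h (discard_disconnected B)"
proof (rule hackenbush.expand, intro conjI)
  show "edges (discard_disconnected (flower_graph h B)) =
    edges (flower_graph h (discard_disconnected B))"
  proof -
    have "filter_mset (\<lambda>e. end1 e \<in> grounded (flower_graph h B) \<and>
        end2 e \<in> grounded (flower_graph h B)) (stem h) = stem h"
      by (subst filter_mset_eq_conv) (auto simp: mem_stem_iff stem_grounded)
    then show ?thesis
      unfolding edges_flower edges_discard attach_edge_cong[OF ground_discard] filter_union_mset
        filter_mset_image_mset attach_sel attach_vertex_grounded_iff
      by (simp only:)
  qed
qed simp

text \<open>\<open>attach_edge\<close> may identify edges that differ only in the choice of ground
  vertex; the image multiset still counts them separately, so one cut removes one copy.\<close>

lemma cut_blossom: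
  assumes "e \<in># edges B"
  shows "cut (attach_edge h B e) (flower_graph h B) = flower_graph h (cut e B)"
proof -
  obtain N where N: "edges B = add_mset e N"
    using assms by (auto dest: multi_member_split)
  have "Hackenbush {0} (edges (flower_graph h B) - {#attach_edge h B e#}) =
      flower_graph h (Hackenbush (ground B) N)"
    using attach_edge_cong[of "Hackenbush (ground B) N" B h] by (simp add: edges_flower N flower_graph_def)
  then show ?thesis
    by (simp add: cut_def N discard_flower)
qed

lemma stem_eq_mset_set: "stem h = mset_set ((\<lambda>i. Edge Green i (Suc i)) ` {..<h})"
  unfolding stem_def by (rule image_mset_mset_set) (simp add: inj_on_def)

lemma cut_stem:
  assumes "i < h"
  shows "cut (Edge Green i (Suc i)) (flower_graph h B) = stalk_graph i"
proof -
  let ?e = "Edge Green i (Suc i)" and ?S = "(\<lambda>i. Edge Green i (Suc i)) ` {..<h}"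
  define K where "K = Hackenbush {0} (edges (flower_graph h B) - {#?e#})"
  have "?e \<in> ?S"
    using assms by auto
  then have "mset_set (?S - {?e}) = stem h - {#?e#}"
    using mset_set_Diff[of ?S "{?e}"] by (simp add: stem_eq_mset_set)
  moreover have "edges K = (stem h - {#?e#}) + image_mset (attach_edge h B) (edges B)"
    using assms by (simp add: K_def edges_flower mem_stem_iff)
  ultimately have edges_K: "edges K = mset_set (?S - {?e}) + image_mset (attach_edge h B) (edges B)"
    by (simp only:)
  \<comment> \<open>The missing edge was the only one joining the vertices up to \<open>i\<close> to
    those above.\<close>
  have "grounded K \<subseteq> {..i}"
  proof (rule grounded_subsetI)
    show "ground K \<subseteq> {..i}"
      by (simp add: K_def)
    fix x assume "x \<in># edges K"
    then consider j where "j \<noteq> i" "x = Edge Green j (Suc j)"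
      | e' where "x = attach_edge h B e'"
      unfolding edges_K by auto
    then show "end1 x \<in> {..i} \<longleftrightarrow> end2 x \<in> {..i}"
    proof cases
      case 2
      then show ?thesis
        using assms attach_vertex_ge[of h B "end1 e'"] attach_vertex_ge[of h B "end2 e'"] by simp
    qed auto
  qed
  moreover have "j \<in> grounded K" if "j \<le> i" for j
    using that
  proof (induction j)
    case 0
    then show ?case
      using ground_subset_grounded[of K] by (simp add: K_def)
  next
    case (Suc j)
    then have "Edge Green j (Suc j) \<in># edges K"
      using assms unfolding edges_K by auto
    from grounded_end1_iff_end2[OF this] show ?case
      using Suc by simp
  qed
  ultimately have gr: "grounded K = {..i}"
    by auto
  have "filter_mset (\<lambda>x. end1 x \<in> {..i} \<and> end2 x \<in> {..i})
      (image_mset (attach_edge h B) (edges B)) = {#}"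
  proof -
    have "\<not> attach_vertex h B v \<le> i" for v
      using assms attach_vertex_ge[of h B v] by simp
    then show ?thesis
      by (subst filter_mset_eq_conv) auto
  qed
  moreover have "filter_mset (\<lambda>x. end1 x \<in> {..i} \<and> end2 x \<in> {..i}) (mset_set (?S - {?e})) =
      stem i"
  proof -
    have "{x \<in> ?S - {?e}. end1 x \<in> {..i} \<and> end2 x \<in> {..i}} =
        (\<lambda>i. Edge Green i (Suc i)) ` {..<i}"
      using assms by auto
    then show ?thesis
      by (subst filter_mset_mset_set) (simp_all only: stem_eq_mset_set finite_Diff finite_imageI finite_lessThan)
  qed
  ultimately have "edges (discard_disconnected K) = stem i"
    unfolding edges_discard gr edges_K filter_union_mset by simp
  then show ?thesis
    by (intro hackenbush.expand) (simp add: cut_def stalk_graph_def K_def)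
qed

section \<open>Flower games as ordinal sums\<close>

lemma game_eqI: "(\<And>p. options p G = options p H) \<Longrightarrow> G = H"
  by (metis game.expand options.simps)

lemma hackenbush_no_edges [simp]: "hackenbush_game (Hackenbush A {#}) = 0"
  by (rule game_eqI) (auto simp: options_hackenbush_iff cuttable_iff)

lemma stalk_graph_eq_flower: "stalk_graph h = flower_graph h (Hackenbush {} {#})"
  by (simp add: stalk_graph_def flower_graph_def)

lemma cuttable_flower_iff:
  "x |\<in>| cuttable p (flower_graph h B) \<longleftrightarrow> (\<exists>i<h. x = Edge Green i (Suc i)) \<or>
     (\<exists>e. e |\<in>| cuttable p B \<and> x = attach_edge h B e)"
  by (cases p) (auto simp: cuttable_iff edges_flower mem_stem_iff)

text \<open>The options correspond: cutting the stem gives a nimber, cutting the blossom keeps the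
  stem. This yields equality of games, not just of values.\<close>

lemma hackenbush_flower:
  "hackenbush_game (flower_graph h B) = stemmed h (hackenbush_game B)"
proof (induction "h + size (edges B)" arbitrary: h B rule: less_induct)
  case less
  show ?case
  proof (rule game_eqI, rule fset_eqI)
    fix p G'
    \<comment> \<open>The measure drops because the stalk of height \<open>i\<close> counts as a
      flower whose blossom has no edges.\<close>
    have stalk: "hackenbush_game (cut (Edge Green i (Suc i)) (flower_graph h B)) = stemmed i 0"
      if "i < h" for i
      using less[of i "Hackenbush {} {#}"] that by (simp add: cut_stem stalk_graph_eq_flower)
    have blossom: "hackenbush_game (cut (attach_edge h B e) (flower_graph h B)) =
        stemmed h (hackenbush_game (cut e B))" if "e |\<in>| cuttable p B" for e
      using less[of h "cut e B"] size_cut[OF that] that by (simp add: cut_blossom cuttable_iff)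
    show "G' |\<in>| options p (hackenbush_game (flower_graph h B)) \<longleftrightarrow>
      G' |\<in>| options p (stemmed h (hackenbush_game B))"
      unfolding options_hackenbush_iff options_stemmed_iff cuttable_flower_iff
      using stalk blossom by (metis (no_types, lifting))
  qed
qed

section \<open>Flowerbeds\<close>

fun component :: "plant \<Rightarrow> nat \<times> game" where
  "component (Stalk h) = (h, 0)"
| "component (Flower h B) = (h, hackenbush_game B)"

lemma plant_game_component: "plant_game f = stemmed (fst (component f)) (snd (component f))"
  by (cases f) (simp_all add: stalk_graph_eq_flower hackenbush_flower)

lemma fst_component: "fst (component f) = height f"
  by (cases f) auto

lemma sum_game_eq_bed_sum: "sum_game F = bed_sum (image_mset component F)"
  by (simp add: sum_game_def bed_sum_def plant_game_component multiset.map_comp comp_def)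

lemma valid_components:
  assumes "\<forall>f\<in>#F. generalized_flower f \<or> is_stalk f"
  shows "valid (image_mset component F)"
  unfolding valid_def
proof
  fix c assume "c \<in># image_mset component F"
  then obtain f where "generalized_flower f \<or> is_stalk f" "c = component f"
    using assms by auto
  then show "never_fuzzy (snd c) \<and> (fst c = 0 \<longrightarrow> snd c = 0)"
    by (cases f) (auto simp: hackenbush_position_def intro: never_fuzzy_zero never_fuzzy_hackenbush)
qed

text \<open>The twin of a short sum contributes one star, the change of convention another, and the
  two cancel. A tall sum is its own twin and falls under \<open>misere_tall\<close>.\<close>

lemma outcome_evil_twin:
  assumes "\<forall>f\<in>#F. generalized_flower f \<or> is_stalk f"
  shows "o\<^sup>- (sum_game (evil_twin F)) = o\<^sup>+ (sum_game F)"
proof -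
  let ?M = "image_mset component F"
  have valid: "valid ?M"
    by (rule valid_components[OF assms])
  have short: "short ?M \<longleftrightarrow> \<not> (\<exists>f\<in>#F. height f \<ge> 2)"
    by (auto simp: short_def fst_component)
  have "wins_first Misere p (sum_game (evil_twin F)) \<longleftrightarrow> wins_first Normal p (sum_game F)" for p
  proof (cases "short ?M")
    case True
    then have "evil_twin F = add_mset (Stalk 1) F"
      by (auto simp: evil_twin_def short)
    then have "wins_first Misere p (sum_game (evil_twin F)) \<longleftrightarrow>
        wins_first Misere p (bed_sum (add_mset (1, 0) ?M))"
      by (simp add: sum_game_eq_bed_sum)
    also have "\<dots> \<longleftrightarrow> wins_first Normal p (bed_sum ?M + (stemmed 1 0 + stemmed 1 0))"
      using True valid by (subst misere_short) (auto simp: never_fuzzy_zero ac_simps)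
    also have "\<dots> \<longleftrightarrow> wins_first Normal p (sum_game F)"
      by (simp only: wins_first_plus_previous_player_win[OF survives_nimber_nimber]
          sum_game_eq_bed_sum)
    finally show ?thesis .
  next
    case False
    then have "evil_twin F = F"
      using short by (auto simp: evil_twin_def)
    then show ?thesis
      using misere_tall[OF False valid] by (simp add: sum_game_eq_bed_sum)
  qed
  then show ?thesis
    by (simp add: outcome_def)
qed

lemma generalized_flowerbed_plants:
  "generalized_flowerbed n F \<Longrightarrow> \<forall>f\<in>#F. generalized_flower f \<or> is_stalk f"
  by (auto simp: generalized_flowerbed_def blue_flower_def red_flower_def)

text \<open>By the Colon Principle it is enough that the two blossoms sum to a normal-play
  zero.\<close>

lemma survives_cancel:
  assumes "cancel b r"
  shows "survives p (plant_game b + plant_game r)"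
proof -
  obtain h B where b: "b = Flower h B"
    using assms by (cases b) (auto simp: cancel_def blue_flower_def)
  obtain R where r: "r = Flower h R"
    using assms b by (cases r) (auto simp: cancel_def red_flower_def)
  let ?X = "hackenbush_game B" and ?Y = "hackenbush_game R"
  have "abs_nvalue ?Y = abs_nvalue (- ?X)"
    using assms by (simp add: cancel_def b r hackenbush_value_def uminus_nvalue.abs_eq)
  \<comment> \<open>Equality of values is tested in the context \<open>?X\<close>, where the
    negative of \<open>?X\<close> gives a second-player win.\<close>
  then have "o\<^sup>+ (?Y + ?X) = o\<^sup>+ (- ?X + ?X)"
    by (simp add: nvalue.abs_eq_iff)
  also have "\<dots> = outP"
    using survives_plus_uminus[of Left ?X] survives_plus_uminus[of Right ?X]
    by (simp add: outcome_def survives_def add.commute)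
  finally have "survives p (?X + ?Y)"
    by (cases p) (auto simp: outcome_def survives_def add.commute split: if_splits)
  then show ?thesis
    by (simp add: b r hackenbush_flower colon_principle)
qed

lemma outcome_remove_pair:
  assumes "remove_pair F F'"
  shows "o\<^sup>+ (sum_game F) = o\<^sup>+ (sum_game F')"
proof -
  obtain b r where "cancel b r" "F = F' + {#b, r#}"
    using assms by (auto simp: remove_pair_def)
  then have "sum_game F = sum_game F' + (plant_game b + plant_game r)"
    by (simp add: sum_game_def ac_simps)
  then show ?thesis
    using outcome_plus_previous_player_win survives_cancel[OF \<open>cancel b r\<close>] by simp
qed

lemma outcome_trimmed_form:
  assumes "trimmed_form F F\<^sub>t"
  shows "o\<^sup>+ (sum_game F) = o\<^sup>+ (sum_game F\<^sub>t)"
proof -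
  have "remove_pair\<^sup>*\<^sup>* F F\<^sub>t"
    using assms by (simp add: trimmed_form_def)
  then show ?thesis
    by (induction rule: rtranclp_induct) (simp_all add: outcome_remove_pair)
qed

theorem theorem4p22:
  fixes F F\<^sub>t :: "plant multiset" and n n\<^sub>t :: nat
  assumes "generalized_flowerbed n F"
    and "trimmed_form F F\<^sub>t"
    and "generalized_flowerbed n\<^sub>t F\<^sub>t"
  shows "o\<^sup>+ (sum_game F) = o\<^sup>- (sum_game (evil_twin F)) \<and>
    o\<^sup>- (sum_game (evil_twin F)) = o\<^sup>+ (sum_game F\<^sub>t) \<and>
    o\<^sup>+ (sum_game F\<^sub>t) = o\<^sup>- (sum_game (evil_twin F\<^sub>t))"
  using outcome_evil_twin[OF generalized_flowerbed_plants[OF assms(1)]]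
    outcome_evil_twin[OF generalized_flowerbed_plants[OF assms(3)]]
    outcome_trimmed_form[OF assms(2)]
  by simp

end
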